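(* For a lattice-ordered hemiring $R$, the following conditions are equivalent: (i) $\mathcal{R}_{BM}(R)=0$; (ii) $\mathcal{R}_{\mathfrak{C}_s}(R)=0$; (iii) $R$ is semiisomorphic to a subdirect product of simple lattice-ordered semirings; (iv) $R$ is semiisomorphic to a subdirect product of Boolean semifields $\mathbf{B}$.
   Context: A hemiring $(R,+,\cdot,0)$ consists of a commutative monoid $(R,+,0)$ and a semigroup $(R,\cdot)$ such that multiplication distributes over addition on both sides and $0r=0=r0$ for all $r$. A semiring is a hemiring with a multiplicative identity $1$. A hemiring $R$ is lattice-ordered if it is also a lattice $(R,\vee,\wedge)$ such that for all $a,b\in R$, $a+b=a\vee b$ and $ab\le a\wedge b$ in the lattice order. Ideals are two-sided and are regarded as hemirings. A hemiring $R$ is ideal-simple if its only ideals are $0$ and $R$; congruence-simple if its only (hemiring) congruences are the diagonal and $R^2$; simple if it is both ideal-simple and congruence-simple. $\mathbf{B}=\{0,1\}$ is the Boolean semifield, with $1+1=1$. Brown-McCoy radical: let $\mathcal{U}\mathbb{S}$ be the class of all hemirings having no nonzero homomorphic image that is an ideal-simple semiring. $\mathcal{R}_{BM}(R)$ is the union of all ideals of $R$ belonging to $\mathcal{U}\mathbb{S}$ (it is the greatest such ideal). $\mathfrak{C}_s$ is the set of all congruences $\rho$ on $R$ such that $R/\rho$ is a nonzero simple semiring; for $\rho\in\mathfrak{C}_s$, $[0_\rho]:=\{r\in R\mid(r,0)\in\rho\}$; and $\mathcal{R}_{\mathfrak{C}_s}(R):=\bigcap\{[0_\rho]\mid\rho\in\mathfrak{C}_s\}$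 (equal to $R$ if $\mathfrak{C}_s=\emptyset$). A semiisomorphism is a surjective hemiring homomorphism $f:R\to S$ with $\{a\mid f(a)=0\}=0$; $R$ is semiisomorphic to $S$ if there is a semiisomorphism $R\to S$. A subdirect product of hemirings $(R_i)_{i\in I}$ is a subhemiring $S$ of $\prod_{i\in I}R_i$ such that every projection restricted to $S$ is surjective onto $R_i$. *)

theory Defs
  imports "HOL-Algebra.Ring" "HOL-Algebra.Lattice"
begin

text \<open>Hemirings are carried by the library's ring records.  A hemiring need not have a
  multiplicative identity, so the \<open>one\<close> field of the record is ignored throughout: being a
  semiring is the existence of an identity in the carrier.  In particular
  \<open>R\<lparr>carrier := I\<rparr>\<close> is a legitimate way of regarding an ideal \<open>I\<close> as a hemiring.\<close>

locale hemiring = abelian_monoid R for R (structure) +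
  assumes m_closed: "\<lbrakk>x \<in> carrier R; y \<in> carrier R\<rbrakk> \<Longrightarrow> x \<otimes> y \<in> carrier R"
    and m_assoc: "\<lbrakk>x \<in> carrier R; y \<in> carrier R; z \<in> carrier R\<rbrakk> \<Longrightarrow> (x \<otimes> y) \<otimes> z = x \<otimes> (y \<otimes> z)"
    and l_distr: "\<lbrakk>x \<in> carrier R; y \<in> carrier R; z \<in> carrier R\<rbrakk> \<Longrightarrow> (x \<oplus> y) \<otimes> z = x \<otimes> z \<oplus> y \<otimes> z"
    and r_distr: "\<lbrakk>x \<in> carrier R; y \<in> carrier R; z \<in> carrier R\<rbrakk> \<Longrightarrow> z \<otimes> (x \<oplus> y) = z \<otimes> x \<oplus> z \<otimes> y"
    and l_null: "x \<in> carrier R \<Longrightarrow> \<zero> \<otimes> x = \<zero>"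
    and r_null: "x \<in> carrier R \<Longrightarrow> x \<otimes> \<zero> = \<zero>"

definition is_semiring :: "('a, 'm) ring_scheme \<Rightarrow> bool" where
  "is_semiring R \<longleftrightarrow> hemiring R \<and>
     (\<exists>e\<in>carrier R. \<forall>x\<in>carrier R. e \<otimes>\<^bsub>R\<^esub> x = x \<and> x \<otimes>\<^bsub>R\<^esub> e = x)"

definition lattice_ordered :: "('a, 'm) ring_scheme \<Rightarrow> bool" where
  "lattice_ordered R \<longleftrightarrow> hemiring R \<and>
     (\<exists>r. let L = \<lparr>carrier = carrier R, eq = (=), le = r\<rparr> in
        lattice L \<and>
        (\<forall>a\<in>carrier R. \<forall>b\<in>carrier R.
           a \<oplus>\<^bsub>R\<^esub> b = a \<squnion>\<^bsub>L\<^esub> b \<and> a \<otimes>\<^bsub>R\<^esub> b \<sqsubseteq>\<^bsub>L\<^esub> a \<sqinter>\<^bsub>L\<^esub> b))"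

definition hemiring_hom ::
  "('a, 'm) ring_scheme \<Rightarrow> ('b, 'n) ring_scheme \<Rightarrow> ('a \<Rightarrow> 'b) set" where
  "hemiring_hom R S = {f \<in> carrier R \<rightarrow> carrier S.
     f \<zero>\<^bsub>R\<^esub> = \<zero>\<^bsub>S\<^esub> \<and>
     (\<forall>x\<in>carrier R. \<forall>y\<in>carrier R.
        f (x \<oplus>\<^bsub>R\<^esub> y) = f x \<oplus>\<^bsub>S\<^esub> f y \<and> f (x \<otimes>\<^bsub>R\<^esub> y) = f x \<otimes>\<^bsub>S\<^esub> f y)}"

definition hemiring_ideal :: "'a set \<Rightarrow> ('a, 'm) ring_scheme \<Rightarrow> bool" where
  "hemiring_ideal I R \<longleftrightarrow> I \<subseteq> carrier R \<and> \<zero>\<^bsub>R\<^esub> \<in> I \<and>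
     (\<forall>x\<in>I. \<forall>y\<in>I. x \<oplus>\<^bsub>R\<^esub> y \<in> I) \<and>
     (\<forall>x\<in>I. \<forall>r\<in>carrier R. r \<otimes>\<^bsub>R\<^esub> x \<in> I \<and> x \<otimes>\<^bsub>R\<^esub> r \<in> I)"

definition hemiring_congruence :: "('a \<times> 'a) set \<Rightarrow> ('a, 'm) ring_scheme \<Rightarrow> bool" where
  "hemiring_congruence \<rho> R \<longleftrightarrow> equiv (carrier R) \<rho> \<and>
     (\<forall>(a, b)\<in>\<rho>. \<forall>(c, d)\<in>\<rho>.
        (a \<oplus>\<^bsub>R\<^esub> c, b \<oplus>\<^bsub>R\<^esub> d) \<in> \<rho> \<and> (a \<otimes>\<^bsub>R\<^esub> c, b \<otimes>\<^bsub>R\<^esub> d) \<in> \<rho>)"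

definition ideal_simple :: "('a, 'm) ring_scheme \<Rightarrow> bool" where
  "ideal_simple R \<longleftrightarrow> hemiring R \<and>
     (\<forall>I. hemiring_ideal I R \<longrightarrow> I = {\<zero>\<^bsub>R\<^esub>} \<or> I = carrier R)"

definition congruence_simple :: "('a, 'm) ring_scheme \<Rightarrow> bool" where
  "congruence_simple R \<longleftrightarrow> hemiring R \<and>
     (\<forall>\<rho>. hemiring_congruence \<rho> R \<longrightarrow> \<rho> = Id_on (carrier R) \<or> \<rho> = carrier R \<times> carrier R)"

definition simple_hemiring :: "('a, 'm) ring_scheme \<Rightarrow> bool" where
  "simple_hemiring R \<longleftrightarrow> ideal_simple R \<and> congruence_simple R"

definition quotient_hemiring :: "('a, 'm) ring_scheme \<Rightarrow> ('a \<times> 'a) set \<Rightarrow> 'a set ring" where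
  "quotient_hemiring R \<rho> =
     \<lparr>carrier = carrier R // \<rho>,
      mult = (\<lambda>X Y. \<Union>x\<in>X. \<Union>y\<in>Y. \<rho> `` {x \<otimes>\<^bsub>R\<^esub> y}),
      one = \<rho> `` {\<one>\<^bsub>R\<^esub>},
      zero = \<rho> `` {\<zero>\<^bsub>R\<^esub>},
      add = (\<lambda>X Y. \<Union>x\<in>X. \<Union>y\<in>Y. \<rho> `` {x \<oplus>\<^bsub>R\<^esub> y})\<rparr>"

text \<open>The class \<open>\<U>\<S>\<close>.  Every homomorphic image of \<open>R\<close> has an isomorphic copy whose elements are
  the fibres of the homomorphism, so quantifying over images of type \<^typ>\<open>'a set ring\<close> covers
  images of all types; this is proved in \<open>BM_class_any_type\<close> below.\<close>

definition BM_class :: "('a, 'm) ring_scheme \<Rightarrow> bool" where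
  "BM_class R \<longleftrightarrow> hemiring R \<and>
     \<not> (\<exists>(S :: 'a set ring) f. f \<in> hemiring_hom R S \<and> f ` carrier R = carrier S \<and>
          carrier S \<noteq> {\<zero>\<^bsub>S\<^esub>} \<and> is_semiring S \<and> ideal_simple S)"

definition BM_radical :: "('a, 'm) ring_scheme \<Rightarrow> 'a set" where
  "BM_radical R = \<Union>{I. hemiring_ideal I R \<and> BM_class (R\<lparr>carrier := I\<rparr>)}"

definition simple_congruences :: "('a, 'm) ring_scheme \<Rightarrow> ('a \<times> 'a) set set" where
  "simple_congruences R = {\<rho>. hemiring_congruence \<rho> R \<and>
     (let Q = quotient_hemiring R \<rho>
      in carrier Q \<noteq> {\<zero>\<^bsub>Q\<^esub>} \<and> is_semiring Q \<and> simple_hemiring Q)}"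

definition zero_class :: "('a, 'm) ring_scheme \<Rightarrow> ('a \<times> 'a) set \<Rightarrow> 'a set" where
  "zero_class R \<rho> = {r \<in> carrier R. (r, \<zero>\<^bsub>R\<^esub>) \<in> \<rho>}"

text \<open>Intersecting with the carrier only matters when there is no simple congruence.\<close>

definition Cs_radical :: "('a, 'm) ring_scheme \<Rightarrow> 'a set" where
  "Cs_radical R = carrier R \<inter> (\<Inter>\<rho>\<in>simple_congruences R. zero_class R \<rho>)"

definition boolean_semifield :: "bool ring" where
  "boolean_semifield = \<lparr>carrier = UNIV, mult = (\<and>), one = True, zero = False, add = (\<or>)\<rparr>"

definition product_hemiring :: "'i set \<Rightarrow> ('i \<Rightarrow> ('b, 'm) ring_scheme) \<Rightarrow> ('i \<Rightarrow> 'b) ring" where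
  "product_hemiring I T =
     \<lparr>carrier = (\<Pi>\<^sub>E i\<in>I. carrier (T i)),
      mult = (\<lambda>x y. \<lambda>i\<in>I. x i \<otimes>\<^bsub>T i\<^esub> y i),
      one = (\<lambda>i\<in>I. \<one>\<^bsub>T i\<^esub>),
      zero = (\<lambda>i\<in>I. \<zero>\<^bsub>T i\<^esub>),
      add = (\<lambda>x y. \<lambda>i\<in>I. x i \<oplus>\<^bsub>T i\<^esub> y i)\<rparr>"

definition subhemiring :: "'a set \<Rightarrow> ('a, 'm) ring_scheme \<Rightarrow> bool" where
  "subhemiring S R \<longleftrightarrow> S \<subseteq> carrier R \<and> \<zero>\<^bsub>R\<^esub> \<in> S \<and>
     (\<forall>x\<in>S. \<forall>y\<in>S. x \<oplus>\<^bsub>R\<^esub> y \<in> S \<and> x \<otimes>\<^bsub>R\<^esub> y \<in> S)"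

definition subdirect_product :: "('i \<Rightarrow> 'b) set \<Rightarrow> 'i set \<Rightarrow> ('i \<Rightarrow> ('b, 'm) ring_scheme) \<Rightarrow> bool" where
  "subdirect_product S I T \<longleftrightarrow> subhemiring S (product_hemiring I T) \<and>
     (\<forall>i\<in>I. (\<lambda>x. x i) ` S = carrier (T i))"

definition semiisomorphism ::
  "('a, 'm) ring_scheme \<Rightarrow> ('b, 'n) ring_scheme \<Rightarrow> ('a \<Rightarrow> 'b) \<Rightarrow> bool" where
  "semiisomorphism R S f \<longleftrightarrow> f \<in> hemiring_hom R S \<and> f ` carrier R = carrier S \<and>
     {a \<in> carrier R. f a = \<zero>\<^bsub>S\<^esub>} = {\<zero>\<^bsub>R\<^esub>}"

definition semiisomorphic :: "('a, 'm) ring_scheme \<Rightarrow> ('b, 'n) ring_scheme \<Rightarrow> bool" where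
  "semiisomorphic R S \<longleftrightarrow> (\<exists>f. semiisomorphism R S f)"

text \<open>The index set may be empty; the product is then the zero hemiring, which is what makes
  the zero hemiring satisfy these two conditions.

  HOL cannot quantify over the types of the index set and of the factors.  The types chosen here
  lose nothing: if \<open>R\<close> is semiisomorphic to a subdirect product of hemirings of any type indexed
  by a set of any type, then factors inducing the same congruence on \<open>R\<close> may be identified and
  each remaining factor replaced by a copy consisting of fibres.  See
  \<open>semiiso_subdirect_simple_any_type\<close> and \<open>semiiso_subdirect_boolean_any_type\<close> below.\<close>

definition semiiso_subdirect_simple :: "('a, 'm) ring_scheme \<Rightarrow> bool" where
  "semiiso_subdirect_simple R \<longleftrightarrow>
     (\<exists>(I :: ('a \<times> 'a) set set) (T :: ('a \<times> 'a) set \<Rightarrow> 'a set ring) S.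
        (\<forall>i\<in>I. is_semiring (T i) \<and> simple_hemiring (T i) \<and> lattice_ordered (T i)) \<and>
        subdirect_product S I T \<and>
        semiisomorphic R ((product_hemiring I T)\<lparr>carrier := S\<rparr>))"

definition semiiso_subdirect_boolean :: "('a, 'm) ring_scheme \<Rightarrow> bool" where
  "semiiso_subdirect_boolean R \<longleftrightarrow>
     (\<exists>(I :: ('a \<times> 'a) set set) S.
        subdirect_product S I (\<lambda>_. boolean_semifield) \<and>
        semiisomorphic R ((product_hemiring I (\<lambda>_. boolean_semifield))\<lparr>carrier := S\<rparr>))"


section \<open>Adequacy of the definitions\<close>

lemma is_semiring_iff_semiring:
  "is_semiring R \<longleftrightarrow> (\<exists>e. semiring (R\<lparr>one := e\<rparr>))"
proof
  assume "is_semiring R"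
  then obtain e where e: "e \<in> carrier R" "\<And>x. x \<in> carrier R \<Longrightarrow> e \<otimes>\<^bsub>R\<^esub> x = x \<and> x \<otimes>\<^bsub>R\<^esub> e = x"
    and "hemiring R" by (auto simp: is_semiring_def)
  interpret hemiring R by fact
  have "semiring (R\<lparr>one := e\<rparr>)"
    by (unfold_locales)
       (use e in \<open>auto simp: a_ac m_closed m_assoc l_distr r_distr l_null r_null\<close>)
  then show "\<exists>e. semiring (R\<lparr>one := e\<rparr>)" ..
next
  assume "\<exists>e. semiring (R\<lparr>one := e\<rparr>)"
  then obtain e where "semiring (R\<lparr>one := e\<rparr>)" ..
  then interpret E: semiring "R\<lparr>one := e\<rparr>" .
  have "hemiring R"
    by (unfold_locales)
       (use E.a_assoc E.a_comm E.m_closed E.m_assoc E.l_distr E.r_distr E.l_null E.r_null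
          E.a_closed E.zero_closed E.l_zero E.r_zero in \<open>simp_all\<close>)
  then show "is_semiring R"
    unfolding is_semiring_def using E.one_closed E.l_one E.r_one by auto
qed

definition copy_along :: "('b \<Rightarrow> 'c) \<Rightarrow> ('b, 'm) ring_scheme \<Rightarrow> 'c ring" where
  "copy_along h T = (let k = inv_into (carrier T) h in
     \<lparr>carrier = h ` carrier T,
      mult = (\<lambda>x y. h (k x \<otimes>\<^bsub>T\<^esub> k y)),
      one = h \<one>\<^bsub>T\<^esub>,
      zero = h \<zero>\<^bsub>T\<^esub>,
      add = (\<lambda>x y. h (k x \<oplus>\<^bsub>T\<^esub> k y))\<rparr>)"

definition hiso :: "('b, 'm) ring_scheme \<Rightarrow> ('c, 'n) ring_scheme \<Rightarrow> ('b \<Rightarrow> 'c) \<Rightarrow> bool" where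
  "hiso T T' h \<longleftrightarrow> hemiring T \<and> h \<in> hemiring_hom T T' \<and> inj_on h (carrier T) \<and>
     carrier T' = h ` carrier T"

lemma hiso_copy_along:
  assumes "hemiring T" "inj_on h (carrier T)"
  shows "hiso T (copy_along h T) h"
  using assms by (auto simp: hiso_def hemiring_hom_def copy_along_def Let_def)

lemma hisoD:
  assumes "hiso T T' h"
  shows "h \<zero>\<^bsub>T\<^esub> = \<zero>\<^bsub>T'\<^esub>" "carrier T' = h ` carrier T"
    "\<And>x y. x \<in> carrier T \<Longrightarrow> y \<in> carrier T \<Longrightarrow> h x \<oplus>\<^bsub>T'\<^esub> h y = h (x \<oplus>\<^bsub>T\<^esub> y)"
    "\<And>x y. x \<in> carrier T \<Longrightarrow> y \<in> carrier T \<Longrightarrow> h x \<otimes>\<^bsub>T'\<^esub> h y = h (x \<otimes>\<^bsub>T\<^esub> y)"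
    "\<And>x y. x \<in> carrier T \<Longrightarrow> y \<in> carrier T \<Longrightarrow> h x = h y \<longleftrightarrow> x = y"
  using assms by (auto simp: hiso_def hemiring_hom_def inj_on_def)

lemma hiso_hemiring:
  assumes "hiso T T' h"
  shows "hemiring T'"
proof -
  interpret hemiring T using assms by (simp add: hiso_def)
  note I = hisoD[OF assms]
  have Z: "\<zero>\<^bsub>T'\<^esub> = h \<zero>\<^bsub>T\<^esub>" using I(1) by simp
  show ?thesis
    by (unfold_locales)
       (auto simp: I(2-4) Z m_closed m_assoc l_distr r_distr l_null r_null a_ac)
qed

lemma hiso_is_semiring:
  assumes "hiso T T' h" "is_semiring T"
  shows "is_semiring T'"
proof -
  obtain e where e: "e \<in> carrier T" "\<And>x. x \<in> carrier T \<Longrightarrow> e \<otimes>\<^bsub>T\<^esub> x = x \<and> x \<otimes>\<^bsub>T\<^esub> e = x"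
    using assms(2) by (auto simp: is_semiring_def)
  then have "h e \<in> carrier T'" "\<forall>y\<in>carrier T'. h e \<otimes>\<^bsub>T'\<^esub> y = y \<and> y \<otimes>\<^bsub>T'\<^esub> h e = y"
    by (auto simp: hisoD[OF assms(1)])
  then show ?thesis
    using hiso_hemiring[OF assms(1)] unfolding is_semiring_def by blast
qed

lemma hiso_nonzero:
  assumes "hiso T T' h" "carrier T \<noteq> {\<zero>\<^bsub>T\<^esub>}"
  shows "carrier T' \<noteq> {\<zero>\<^bsub>T'\<^esub>}"
proof -
  interpret hemiring T using assms by (simp add: hiso_def)
  obtain x where "x \<in> carrier T" "x \<noteq> \<zero>\<^bsub>T\<^esub>" using assms(2) zero_closed by blast
  then have "h x \<in> carrier T'" "h x \<noteq> \<zero>\<^bsub>T'\<^esub>"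
    using hisoD[OF assms(1)] zero_closed by (auto simp flip: hisoD(1)[OF assms(1)])
  then show ?thesis by blast
qed

lemma hiso_ideal_simple:
  assumes "hiso T T' h" "ideal_simple T"
  shows "ideal_simple T'"
  unfolding ideal_simple_def
proof (intro conjI allI impI hiso_hemiring[OF assms(1)])
  interpret hemiring T using assms by (simp add: hiso_def)
  note I = hisoD[OF assms(1)]
  fix J assume J: "hemiring_ideal J T'"
  let ?J = "{x \<in> carrier T. h x \<in> J}"
  have JT: "J = h ` ?J" using J I(2) by (auto simp: hemiring_ideal_def)
  have "hemiring_ideal ?J T"
    using J by (auto simp: hemiring_ideal_def I(1,2) m_closed simp flip: I(3,4))
  then have "?J = {\<zero>\<^bsub>T\<^esub>} \<or> ?J = carrier T" using assms(2) by (auto simp: ideal_simple_def)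
  then show "J = {\<zero>\<^bsub>T'\<^esub>} \<or> J = carrier T'" using JT I(1,2) by auto
qed

lemma hiso_congruence_simple:
  assumes "hiso T T' h" "congruence_simple T"
  shows "congruence_simple T'"
  unfolding congruence_simple_def
proof (intro conjI allI impI hiso_hemiring[OF assms(1)])
  interpret hemiring T using assms by (simp add: hiso_def)
  note I = hisoD[OF assms(1)]
  fix \<rho> assume \<rho>: "hemiring_congruence \<rho> T'"
  let ?\<rho> = "{(x, y). x \<in> carrier T \<and> y \<in> carrier T \<and> (h x, h y) \<in> \<rho>}"
  have eq: "equiv (carrier T') \<rho>" using \<rho> by (simp add: hemiring_congruence_def)
  have sub: "\<rho> \<subseteq> carrier T' \<times> carrier T'" using eq by (simp add: equiv_def)
  have \<rho>T: "\<rho> = map_prod h h ` ?\<rho>"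
  proof (intro equalityI subsetI)
    fix p assume "p \<in> \<rho>"
    moreover from this sub obtain x y where "x \<in> carrier T" "y \<in> carrier T" "p = (h x, h y)"
      unfolding I(2) by blast
    ultimately show "p \<in> map_prod h h ` ?\<rho>" by (auto intro!: image_eqI[of _ _ "(x, y)"])
  qed auto
  have "equiv (carrier T) ?\<rho>"
  proof (rule equivI)
    show "refl_on (carrier T) ?\<rho>" using eq I(2) by (auto simp: equiv_def refl_on_def)
    show "sym ?\<rho>" using eq by (auto simp: equiv_def sym_def)
    show "trans ?\<rho>" using eq by (auto simp: equiv_def trans_def)
  qed auto
  moreover have "\<forall>(a, b)\<in>?\<rho>. \<forall>(c, d)\<in>?\<rho>.
      (a \<oplus>\<^bsub>T\<^esub> c, b \<oplus>\<^bsub>T\<^esub> d) \<in> ?\<rho> \<and> (a \<otimes>\<^bsub>T\<^esub> c, b \<otimes>\<^bsub>T\<^esub> d) \<in> ?\<rho>"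
    using \<rho> by (auto simp: hemiring_congruence_def m_closed simp flip: I(3,4))
  ultimately have "hemiring_congruence ?\<rho> T" unfolding hemiring_congruence_def by blast
  then have "?\<rho> = Id_on (carrier T) \<or> ?\<rho> = carrier T \<times> carrier T"
    using assms(2) by (simp add: congruence_simple_def)
  then show "\<rho> = Id_on (carrier T') \<or> \<rho> = carrier T' \<times> carrier T'"
  proof
    assume "?\<rho> = Id_on (carrier T)"
    with \<rho>T have "\<rho> = map_prod h h ` Id_on (carrier T)" by simp
    then show ?thesis using I(2) by (auto simp: Id_on_def)
  next
    assume "?\<rho> = carrier T \<times> carrier T"
    with \<rho>T have "\<rho> = map_prod h h ` (carrier T \<times> carrier T)" by simp
    then show ?thesis using I(2) by (auto simp: map_prod_def)
  qed
qed

lemma (in lattice) join_unique: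
  assumes "least L s (Upper L {x, y})"
  shows "x \<squnion> y = s"
  unfolding join_def sup_def by (rule some_equality) (use assms least_unique in auto)

lemma (in lattice) meet_unique:
  assumes "greatest L s (Lower L {x, y})"
  shows "x \<sqinter> y = s"
  unfolding meet_def inf_def by (rule some_equality) (use assms greatest_unique in auto)

lemma hiso_lattice_ordered:
  assumes "hiso T T' h" "lattice_ordered T"
  shows "lattice_ordered T'"
proof -
  interpret hemiring T using assms by (simp add: hiso_def)
  note I = hisoD[OF assms(1)]
  obtain r where r: "lattice \<lparr>carrier = carrier T, eq = (=), le = r\<rparr>"
    and ops0: "\<And>a b. a \<in> carrier T \<Longrightarrow> b \<in> carrier T \<Longrightarrow>
      a \<oplus>\<^bsub>T\<^esub> b = a \<squnion>\<^bsub>\<lparr>carrier = carrier T, eq = (=), le = r\<rparr>\<^esub> b \<and>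
      r (a \<otimes>\<^bsub>T\<^esub> b) (a \<sqinter>\<^bsub>\<lparr>carrier = carrier T, eq = (=), le = r\<rparr>\<^esub> b)"
    using assms(2) by (auto simp: lattice_ordered_def Let_def)
  let ?L = "\<lparr>carrier = carrier T, eq = (=), le = r\<rparr>"
  have ops: "\<And>a b. a \<in> carrier T \<Longrightarrow> b \<in> carrier T \<Longrightarrow> a \<oplus>\<^bsub>T\<^esub> b = a \<squnion>\<^bsub>?L\<^esub> b \<and> r (a \<otimes>\<^bsub>T\<^esub> b) (a \<sqinter>\<^bsub>?L\<^esub> b)"
    by (rule ops0)
  interpret L: lattice ?L by fact
  define k where "k = inv_into (carrier T) h"
  have k: "\<And>x. x \<in> carrier T \<Longrightarrow> k (h x) = x"
    using assms(1) by (auto simp: k_def hiso_def)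
  let ?L' = "\<lparr>carrier = carrier T', eq = (=), le = (\<lambda>x y. r (k x) (k y))\<rparr>"
  have po: "partial_order ?L'"
    using L.le_refl L.le_antisym L.le_trans by unfold_locales (auto simp: I(2) k, metis)
  have up: "least ?L' (h s) (Upper ?L' {h x, h y})" if "least ?L s (Upper ?L {x, y})"
      "x \<in> carrier T" "y \<in> carrier T" for s x y
    using that by (auto simp: least_def Upper_def I(2) k)
  have lo: "greatest ?L' (h s) (Lower ?L' {h x, h y})" if "greatest ?L s (Lower ?L {x, y})"
      "x \<in> carrier T" "y \<in> carrier T" for s x y
    using that by (auto simp: greatest_def Lower_def I(2) k)
  interpret P: partial_order ?L' by fact
  interpret L': lattice ?L'
  proof unfold_locales
    fix x y assume "x \<in> carrier ?L'" "y \<in> carrier ?L'"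
    then obtain a b where ab: "a \<in> carrier T" "b \<in> carrier T" "x = h a" "y = h b"
      using I(2) by auto
    show "\<exists>s. least ?L' s (Upper ?L' {x, y})"
      using L.sup_of_two_exists[of a b] up[of _ a b] ab by auto
    show "\<exists>s. greatest ?L' s (Lower ?L' {x, y})"
      using L.inf_of_two_exists[of a b] lo[of _ a b] ab by auto
  qed
  have j: "h a \<squnion>\<^bsub>?L'\<^esub> h b = h (a \<squnion>\<^bsub>?L\<^esub> b)" and m: "h a \<sqinter>\<^bsub>?L'\<^esub> h b = h (a \<sqinter>\<^bsub>?L\<^esub> b)"
    if ab: "a \<in> carrier T" "b \<in> carrier T" for a b
  proof -
    obtain s where s: "least ?L s (Upper ?L {a, b})"
      using L.sup_of_two_exists[of a b] ab by auto
    show "h a \<squnion>\<^bsub>?L'\<^esub> h b = h (a \<squnion>\<^bsub>?L\<^esub> b)"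
      using L'.join_unique[OF up[OF s ab]] L.join_unique[OF s] ab I(2) by simp
    obtain s where s: "greatest ?L s (Lower ?L {a, b})"
      using L.inf_of_two_exists[of a b] ab by auto
    show "h a \<sqinter>\<^bsub>?L'\<^esub> h b = h (a \<sqinter>\<^bsub>?L\<^esub> b)"
      using L'.meet_unique[OF lo[OF s ab]] L.meet_unique[OF s] ab I(2) by simp
  qed
  have mc: "a \<sqinter>\<^bsub>?L\<^esub> b \<in> carrier T" if "a \<in> carrier T" "b \<in> carrier T" for a b
    using L.meet_closed[of a b] that by simp
  have "\<forall>a\<in>carrier T'. \<forall>b\<in>carrier T'.
      a \<oplus>\<^bsub>T'\<^esub> b = a \<squnion>\<^bsub>?L'\<^esub> b \<and> a \<otimes>\<^bsub>T'\<^esub> b \<sqsubseteq>\<^bsub>?L'\<^esub> a \<sqinter>\<^bsub>?L'\<^esub> b"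
    unfolding I(2) using ops by (auto simp: I(3,4) j[unfolded I(2)] m[unfolded I(2)] k mc m_closed)
  then show ?thesis
    unfolding lattice_ordered_def Let_def using hiso_hemiring[OF assms(1)] L'.lattice_axioms by blast
qed

lemma inj_on_fibre:
  assumes "f ` A = B"
  shows "inj_on (\<lambda>t. {a \<in> A. f a = t}) B"
  using assms by (auto simp: inj_on_def)

theorem BM_class_any_type:
  fixes R :: "('a, 'm) ring_scheme" and S :: "('b, 'n) ring_scheme"
  assumes "f \<in> hemiring_hom R S" "f ` carrier R = carrier S"
    and "carrier S \<noteq> {\<zero>\<^bsub>S\<^esub>}" "is_semiring S" "ideal_simple S"
  shows "\<not> BM_class R"
proof -
  define h where "h = (\<lambda>t. {a \<in> carrier R. f a = t})"
  have iso: "hiso S (copy_along h S) h"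
    using assms inj_on_fibre[OF assms(2)] by (auto intro!: hiso_copy_along simp: h_def is_semiring_def)
  have "h \<circ> f \<in> hemiring_hom R (copy_along h S)"
    using assms(1) iso by (auto simp: hemiring_hom_def hiso_def Pi_def)
  moreover have "(h \<circ> f) ` carrier R = carrier (copy_along h S)"
    unfolding hisoD(2)[OF iso] assms(2)[symmetric] by (simp add: image_comp)
  ultimately show ?thesis
    unfolding BM_class_def
    using hiso_nonzero[OF iso assms(3)] hiso_is_semiring[OF iso assms(4)]
      hiso_ideal_simple[OF iso assms(5)] by blast
qed

lemma semiiso_subdirectE:
  assumes "subdirect_product S I T" "semiisomorphic R ((product_hemiring I T)\<lparr>carrier := S\<rparr>)"
  obtains f where
    "\<And>i. i \<in> I \<Longrightarrow> (\<lambda>a. f a i) \<in> hemiring_hom R (T i)"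
    "\<And>i. i \<in> I \<Longrightarrow> (\<lambda>a. f a i) ` carrier R = carrier (T i)"
    "\<And>a. a \<in> carrier R \<Longrightarrow> (\<forall>i\<in>I. f a i = \<zero>\<^bsub>T i\<^esub>) \<Longrightarrow> a = \<zero>\<^bsub>R\<^esub>"
proof -
  obtain f where f: "f \<in> hemiring_hom R ((product_hemiring I T)\<lparr>carrier := S\<rparr>)"
      "f ` carrier R = S" "{a \<in> carrier R. f a = (\<lambda>i\<in>I. \<zero>\<^bsub>T i\<^esub>)} = {\<zero>\<^bsub>R\<^esub>}"
    using assms(2) by (auto simp: semiisomorphic_def semiisomorphism_def product_hemiring_def)
  have S: "S \<subseteq> (\<Pi>\<^sub>E i\<in>I. carrier (T i))" "\<And>i. i \<in> I \<Longrightarrow> (\<lambda>x. x i) ` S = carrier (T i)"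
    using assms(1) by (auto simp: subdirect_product_def subhemiring_def product_hemiring_def)
  show thesis
  proof (rule that[of f])
    fix i assume i: "i \<in> I"
    have *: "(\<lambda>a. f a i) ` carrier R = (\<lambda>x. x i) ` (f ` carrier R)" by (simp add: image_image)
    show eq: "(\<lambda>a. f a i) ` carrier R = carrier (T i)"
      unfolding * f(2) by (rule S(2)[OF i])
    show "(\<lambda>a. f a i) \<in> hemiring_hom R (T i)"
      using f(1) i eq by (auto simp: hemiring_hom_def product_hemiring_def)
  next
    fix a assume a: "a \<in> carrier R" "\<forall>i\<in>I. f a i = \<zero>\<^bsub>T i\<^esub>"
    then have "f a \<in> (\<Pi>\<^sub>E i\<in>I. carrier (T i))" using f(2) S(1) by blast
    then have "f a = (\<lambda>i\<in>I. \<zero>\<^bsub>T i\<^esub>)" using a(2) by (auto simp: PiE_def extensional_def fun_eq_iff)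
    then show "a = \<zero>\<^bsub>R\<^esub>" using a(1) f(3) by blast
  qed
qed

lemma semiiso_subdirectI:
  assumes "hemiring R"
    and "\<And>i. i \<in> I \<Longrightarrow> g i \<in> hemiring_hom R (T i)"
    and "\<And>i. i \<in> I \<Longrightarrow> g i ` carrier R = carrier (T i)"
    and "\<And>a. a \<in> carrier R \<Longrightarrow> (\<forall>i\<in>I. g i a = \<zero>\<^bsub>T i\<^esub>) \<Longrightarrow> a = \<zero>\<^bsub>R\<^esub>"
  shows "\<exists>S. subdirect_product S I T \<and> semiisomorphic R ((product_hemiring I T)\<lparr>carrier := S\<rparr>)"
proof -
  interpret hemiring R by fact
  define f where "f = (\<lambda>a. \<lambda>i\<in>I. g i a)"
  define S where "S = f ` carrier R"
  let ?P = "product_hemiring I T"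
  have z: "\<zero>\<^bsub>?P\<^esub> = f \<zero>\<^bsub>R\<^esub>"
    using assms(2) by (auto simp: product_hemiring_def f_def hemiring_hom_def fun_eq_iff)
  have ad: "f a \<oplus>\<^bsub>?P\<^esub> f b = f (a \<oplus>\<^bsub>R\<^esub> b)" if "a \<in> carrier R" "b \<in> carrier R" for a b
    using assms(2) that by (auto simp: product_hemiring_def f_def hemiring_hom_def fun_eq_iff)
  have mu: "f a \<otimes>\<^bsub>?P\<^esub> f b = f (a \<otimes>\<^bsub>R\<^esub> b)" if "a \<in> carrier R" "b \<in> carrier R" for a b
    using assms(2) that by (auto simp: product_hemiring_def f_def hemiring_hom_def fun_eq_iff)
  have "S \<subseteq> carrier ?P"
    using assms(2) by (auto simp: S_def f_def product_hemiring_def hemiring_hom_def Pi_def)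
  then have "subhemiring S ?P"
    by (auto simp: subhemiring_def S_def z ad mu m_closed)
  moreover have "(\<lambda>x. x i) ` S = carrier (T i)" if "i \<in> I" for i
    using assms(3)[OF that] that by (auto simp: S_def f_def image_image)
  moreover have "semiisomorphism R (?P\<lparr>carrier := S\<rparr>) f"
  proof -
    have "a = \<zero>\<^bsub>R\<^esub>" if "a \<in> carrier R" "f a = f \<zero>\<^bsub>R\<^esub>" for a
    proof (rule assms(4)[OF that(1)], rule ballI)
      fix i assume i: "i \<in> I"
      have "g i a = g i \<zero>\<^bsub>R\<^esub>" using fun_cong[OF that(2), of i] i by (simp add: f_def)
      then show "g i a = \<zero>\<^bsub>T i\<^esub>" using assms(2)[OF i] by (simp add: hemiring_hom_def)
    qed
    then show ?thesis
      by (auto simp: semiisomorphism_def hemiring_hom_def z ad mu S_def)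
  qed
  ultimately show ?thesis by (auto simp: subdirect_product_def semiisomorphic_def)
qed

lemma reindex:
  obtains s where "\<And>j. j \<in> k ` I \<Longrightarrow> s j \<in> I" "\<And>j. j \<in> k ` I \<Longrightarrow> k (s j) = j"
  using that[of "inv_into I k"] by (simp add: inv_into_into f_inv_into_f)

theorem semiiso_subdirect_simple_any_type:
  fixes R :: "('a, 'm) ring_scheme" and T :: "'i \<Rightarrow> ('b, 'n) ring_scheme"
  assumes R: "hemiring R"
    and T: "\<forall>i\<in>I. is_semiring (T i) \<and> simple_hemiring (T i) \<and> lattice_ordered (T i)"
    and S: "subdirect_product S I T" "semiisomorphic R ((product_hemiring I T)\<lparr>carrier := S\<rparr>)"
  shows "semiiso_subdirect_simple R"
proof -
  interpret hemiring R by fact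
  obtain f where f: "\<And>i. i \<in> I \<Longrightarrow> (\<lambda>a. f a i) \<in> hemiring_hom R (T i)"
    "\<And>i. i \<in> I \<Longrightarrow> (\<lambda>a. f a i) ` carrier R = carrier (T i)"
    "\<And>a. a \<in> carrier R \<Longrightarrow> (\<forall>i\<in>I. f a i = \<zero>\<^bsub>T i\<^esub>) \<Longrightarrow> a = \<zero>\<^bsub>R\<^esub>"
    using semiiso_subdirectE[OF S] by metis
  define k where "k = (\<lambda>i. {(a, b). a \<in> carrier R \<and> b \<in> carrier R \<and> f a i = f b i})"
  obtain s where s: "\<And>j. j \<in> k ` I \<Longrightarrow> s j \<in> I" "\<And>j. j \<in> k ` I \<Longrightarrow> k (s j) = j"
    using reindex[of k I] by metis
  define h where "h = (\<lambda>j t. {a \<in> carrier R. f a (s j) = t})"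
  define T' where "T' = (\<lambda>j. copy_along (h j) (T (s j)))"
  have iso: "hiso (T (s j)) (T' j) (h j)" if "j \<in> k ` I" for j
    unfolding T'_def
  proof (rule hiso_copy_along)
    show "hemiring (T (s j))" using bspec[OF T s(1)[OF that]] by (simp add: is_semiring_def)
    show "inj_on (h j) (carrier (T (s j)))"
      unfolding h_def by (rule inj_on_fibre[OF f(2)[OF s(1)[OF that]]])
  qed
  have props: "\<forall>j\<in>k ` I. is_semiring (T' j) \<and> simple_hemiring (T' j) \<and> lattice_ordered (T' j)"
  proof
    fix j assume j: "j \<in> k ` I"
    have "is_semiring (T (s j))" "ideal_simple (T (s j))" "congruence_simple (T (s j))"
      "lattice_ordered (T (s j))"
      using bspec[OF T s(1)[OF j]] by (simp_all add: simple_hemiring_def)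
    then show "is_semiring (T' j) \<and> simple_hemiring (T' j) \<and> lattice_ordered (T' j)"
      using iso[OF j] by (simp add: simple_hemiring_def hiso_is_semiring hiso_ideal_simple
        hiso_congruence_simple hiso_lattice_ordered)
  qed
  have "\<exists>S. subdirect_product S (k ` I) T' \<and>
      semiisomorphic R ((product_hemiring (k ` I) T')\<lparr>carrier := S\<rparr>)"
  proof (rule semiiso_subdirectI[where g = "\<lambda>j a. h j (f a (s j))", OF R])
    fix j assume j: "j \<in> k ` I"
    show "(\<lambda>a. h j (f a (s j))) \<in> hemiring_hom R (T' j)"
      using f(1)[OF s(1)[OF j]] iso[OF j] by (auto simp: hemiring_hom_def hiso_def Pi_def)
    show "(\<lambda>a. h j (f a (s j))) ` carrier R = carrier (T' j)"
      unfolding hisoD(2)[OF iso[OF j]] f(2)[OF s(1)[OF j], symmetric] by (simp add: image_image)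
  next
    fix a assume a: "a \<in> carrier R" "\<forall>j\<in>k ` I. h j (f a (s j)) = \<zero>\<^bsub>T' j\<^esub>"
    show "a = \<zero>\<^bsub>R\<^esub>"
    proof (rule f(3)[OF a(1)], rule ballI)
      fix i assume i: "i \<in> I"
      let ?j = "k i"
      have j: "?j \<in> k ` I" using i by simp
      have z: "f \<zero>\<^bsub>R\<^esub> i' = \<zero>\<^bsub>T i'\<^esub>" if "i' \<in> I" for i'
        using f(1)[OF that] by (simp add: hemiring_hom_def)
      have "h ?j (f a (s ?j)) = h ?j (f \<zero>\<^bsub>R\<^esub> (s ?j))"
        unfolding z[OF s(1)[OF j]] hisoD(1)[OF iso[OF j]] by (rule bspec[OF a(2) j])
      then have "f a (s ?j) = f \<zero>\<^bsub>R\<^esub> (s ?j)"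
        using a(1) unfolding h_def by blast
      then have "(a, \<zero>\<^bsub>R\<^esub>) \<in> k (s ?j)" using a(1) unfolding k_def by simp
      then have "(a, \<zero>\<^bsub>R\<^esub>) \<in> k i" using s(2)[OF j] by simp
      then show "f a i = \<zero>\<^bsub>T i\<^esub>" using z[OF i] by (simp add: k_def)
    qed
  qed
  with props show ?thesis unfolding semiiso_subdirect_simple_def
    by (intro exI[of _ "k ` I"] exI[of _ T']) simp
qed

theorem semiiso_subdirect_boolean_any_type:
  fixes R :: "('a, 'm) ring_scheme" and I :: "'i set"
  assumes R: "hemiring R"
    and S: "subdirect_product S I (\<lambda>_. boolean_semifield)"
      "semiisomorphic R ((product_hemiring I (\<lambda>_. boolean_semifield))\<lparr>carrier := S\<rparr>)"
  shows "semiiso_subdirect_boolean R"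
proof -
  interpret hemiring R by fact
  obtain f where f: "\<And>i. i \<in> I \<Longrightarrow> (\<lambda>a. f a i) \<in> hemiring_hom R boolean_semifield"
    "\<And>i. i \<in> I \<Longrightarrow> (\<lambda>a. f a i) ` carrier R = carrier boolean_semifield"
    "\<And>a. a \<in> carrier R \<Longrightarrow> (\<forall>i\<in>I. f a i = \<zero>\<^bsub>boolean_semifield\<^esub>) \<Longrightarrow> a = \<zero>\<^bsub>R\<^esub>"
    using semiiso_subdirectE[OF S] by metis
  define k where "k = (\<lambda>i. {(a, b). a \<in> carrier R \<and> b \<in> carrier R \<and> f a i = f b i})"
  obtain s where s: "\<And>j. j \<in> k ` I \<Longrightarrow> s j \<in> I" "\<And>j. j \<in> k ` I \<Longrightarrow> k (s j) = j"
    using reindex[of k I] by metis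
  have "\<exists>S. subdirect_product S (k ` I) (\<lambda>_. boolean_semifield) \<and>
      semiisomorphic R ((product_hemiring (k ` I) (\<lambda>_. boolean_semifield))\<lparr>carrier := S\<rparr>)"
  proof (rule semiiso_subdirectI[where g = "\<lambda>j a. f a (s j)", OF R f(1)[OF s(1)] f(2)[OF s(1)]])
    fix a assume a: "a \<in> carrier R" "\<forall>j\<in>k ` I. f a (s j) = \<zero>\<^bsub>boolean_semifield\<^esub>"
    show "a = \<zero>\<^bsub>R\<^esub>"
    proof (rule f(3)[OF a(1)], rule ballI)
      fix i assume i: "i \<in> I"
      let ?j = "k i"
      have j: "?j \<in> k ` I" using i by simp
      have z: "f \<zero>\<^bsub>R\<^esub> i' = \<zero>\<^bsub>boolean_semifield\<^esub>" if "i' \<in> I" for i'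
        using f(1)[OF that] by (simp add: hemiring_hom_def)
      have "(a, \<zero>\<^bsub>R\<^esub>) \<in> k (s ?j)"
        using a(1) bspec[OF a(2) j] z[OF s(1)[OF j]] unfolding k_def by simp
      then have "(a, \<zero>\<^bsub>R\<^esub>) \<in> k i" using s(2)[OF j] by simp
      then show "f a i = \<zero>\<^bsub>boolean_semifield\<^esub>" using z[OF i] by (simp add: k_def)
    qed
  qed
  then show ?thesis unfolding semiiso_subdirect_boolean_def by (rule exI)
qed

end

theory Submission
  imports Defs
begin

text \<open>All four conditions say that the surjective homomorphisms \<open>R \<rightarrow> \<^bold>B\<close>, here called
  Boolean characters, separate every nonzero element of \<open>R\<close> from zero.

  The lattice order enters through the absorption law \<open>ab + a = a\<close>, \<open>ab + b = b\<close>,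
  which passes to homomorphic images and to ideals.  Let \<open>S\<close> be an ideal-simple semiring
  with absorption.  Then \<open>1\<close> is the greatest element for the order \<open>x \<le> y \<longleftrightarrow> x + y = y\<close>, and each principal down-set
  \<open>{x. x \<le> a}\<close> is an ideal; so \<open>a \<noteq> 0\<close> forces \<open>1 \<le> a\<close>, that is \<open>a = 1\<close>
  (\<open>ideal_simple_eq_zero_or_one\<close>).  Thus \<open>\<^bold>B\<close> is the only nonzero ideal-simple
  semiring that can be an image of \<open>R\<close> or of one of its ideals, and conversely \<open>\<^bold>B\<close> is simple.

  It follows at once that the radical defined by simple congruences is the intersection of the
  kernels of the characters of \<open>R\<close>.  The Brown-McCoy radical is the same intersection because a
  character that does not vanish on an ideal restricts to a character of the ideal, while
  conversely every character of an ideal extends to the whole hemiring without any change on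
  the ideal (\<open>boolean_character_extend\<close>).  Finally, a semiisomorphism onto a
  subdirect product of copies of \<open>\<^bold>B\<close> is a family of characters whose kernels meet in
  zero, and simple semirings that occur as factors are images of \<open>R\<close>, hence zero or copies
  of \<open>\<^bold>B\<close>.\<close>

section \<open>Absorption\<close>

locale absorptive_hemiring = hemiring +
  assumes absorb_left: "\<lbrakk>x \<in> carrier R; y \<in> carrier R\<rbrakk> \<Longrightarrow> x \<otimes> y \<oplus> x = x"
    and absorb_right: "\<lbrakk>x \<in> carrier R; y \<in> carrier R\<rbrakk> \<Longrightarrow> x \<otimes> y \<oplus> y = y"

lemma lattice_ordered_absorptive:
  assumes "lattice_ordered R"
  shows "absorptive_hemiring R"
proof -
  interpret hemiring R using assms by (simp add: lattice_ordered_def)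
  obtain r where r: "let L = \<lparr>carrier = carrier R, eq = (=), le = r\<rparr> in lattice L \<and>
      (\<forall>a\<in>carrier R. \<forall>b\<in>carrier R.
        a \<oplus>\<^bsub>R\<^esub> b = a \<squnion>\<^bsub>L\<^esub> b \<and> a \<otimes>\<^bsub>R\<^esub> b \<sqsubseteq>\<^bsub>L\<^esub> a \<sqinter>\<^bsub>L\<^esub> b)"
    using assms unfolding lattice_ordered_def by blast
  let ?L = "\<lparr>carrier = carrier R, eq = (=), le = r\<rparr>"
  have L: "lattice ?L"
    and op: "\<And>a b. a \<in> carrier R \<Longrightarrow> b \<in> carrier R \<Longrightarrow>
      a \<oplus>\<^bsub>R\<^esub> b = a \<squnion>\<^bsub>?L\<^esub> b \<and> a \<otimes>\<^bsub>R\<^esub> b \<sqsubseteq>\<^bsub>?L\<^esub> a \<sqinter>\<^bsub>?L\<^esub> b"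
    using r unfolding Let_def by blast+
  interpret L: lattice ?L by fact
  have sup: "a \<oplus>\<^bsub>R\<^esub> b = b" if "a \<in> carrier R" "b \<in> carrier R" "a \<sqsubseteq>\<^bsub>?L\<^esub> b" for a b
  proof -
    have "a \<squnion>\<^bsub>?L\<^esub> b \<sqsubseteq>\<^bsub>?L\<^esub> b" using that L.le_refl[of b] by (intro L.join_le) auto
    moreover have "b \<sqsubseteq>\<^bsub>?L\<^esub> a \<squnion>\<^bsub>?L\<^esub> b" using that by (intro L.join_right) auto
    ultimately show ?thesis
      using op[OF that(1,2)] L.le_antisym L.join_closed[of a b] that by simp
  qed
  have le: "a \<otimes>\<^bsub>R\<^esub> b \<sqsubseteq>\<^bsub>?L\<^esub> a" "a \<otimes>\<^bsub>R\<^esub> b \<sqsubseteq>\<^bsub>?L\<^esub> b"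
    if ab: "a \<in> carrier R" "b \<in> carrier R" for a b
  proof -
    have "a \<sqinter>\<^bsub>?L\<^esub> b \<sqsubseteq>\<^bsub>?L\<^esub> a" "a \<sqinter>\<^bsub>?L\<^esub> b \<sqsubseteq>\<^bsub>?L\<^esub> b"
      using ab L.meet_left[of a b] L.meet_right[of a b] by simp_all
    then show "a \<otimes>\<^bsub>R\<^esub> b \<sqsubseteq>\<^bsub>?L\<^esub> a" "a \<otimes>\<^bsub>R\<^esub> b \<sqsubseteq>\<^bsub>?L\<^esub> b"
      using op[OF ab] ab m_closed[OF ab] L.meet_closed[of a b]
        L.le_trans[of "a \<otimes>\<^bsub>R\<^esub> b" "a \<sqinter>\<^bsub>?L\<^esub> b" a] L.le_trans[of "a \<otimes>\<^bsub>R\<^esub> b" "a \<sqinter>\<^bsub>?L\<^esub> b" b]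
      by auto
  qed
  show ?thesis
    by unfold_locales (auto intro!: sup le m_closed)
qed

lemma absorptive_hemiring_image:
  assumes "absorptive_hemiring R" "f \<in> hemiring_hom R S" "f ` carrier R = carrier S" "hemiring S"
  shows "absorptive_hemiring S"
proof -
  interpret absorptive_hemiring R by fact
  have "f x \<otimes>\<^bsub>S\<^esub> f y \<oplus>\<^bsub>S\<^esub> f x = f x \<and> f x \<otimes>\<^bsub>S\<^esub> f y \<oplus>\<^bsub>S\<^esub> f y = f y"
    if xy: "x \<in> carrier R" "y \<in> carrier R" for x y
  proof -
    have "f (x \<otimes>\<^bsub>R\<^esub> y \<oplus>\<^bsub>R\<^esub> z) = f x \<otimes>\<^bsub>S\<^esub> f y \<oplus>\<^bsub>S\<^esub> f z" if "z \<in> carrier R" for z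
      using assms(2) xy m_closed[OF xy] that by (simp add: hemiring_hom_def)
    then show ?thesis using xy absorb_left[OF xy] absorb_right[OF xy] by metis
  qed
  then show ?thesis
    using assms(4) unfolding absorptive_hemiring_def absorptive_hemiring_axioms_def
      assms(3)[symmetric] by auto
qed

lemma (in absorptive_hemiring) absorptive_hemiring_ideal:
  assumes "hemiring_ideal I R"
  shows "absorptive_hemiring (R\<lparr>carrier := I\<rparr>)"
proof -
  have I: "\<And>x. x \<in> I \<Longrightarrow> x \<in> carrier R" "\<zero> \<in> I"
    "\<And>x y. x \<in> I \<Longrightarrow> y \<in> I \<Longrightarrow> x \<oplus> y \<in> I"
    "\<And>x y. x \<in> I \<Longrightarrow> y \<in> I \<Longrightarrow> x \<otimes> y \<in> I"
    using assms by (auto simp: hemiring_ideal_def)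
  show ?thesis
    by unfold_locales
      (auto simp: I a_assoc m_assoc l_distr r_distr l_null r_null absorb_left absorb_right
        intro: a_comm)
qed

text \<open>In the order \<open>x \<le> y \<longleftrightarrow> x + y = y\<close>, absorption makes \<open>e\<close> the greatest element, and it
  makes the down-set of \<open>a\<close> closed under multiplication by arbitrary elements.\<close>

lemma ideal_simple_eq_zero_or_one:
  assumes "absorptive_hemiring S" "ideal_simple S"
    and e: "e \<in> carrier S" "\<And>x. x \<in> carrier S \<Longrightarrow> e \<otimes>\<^bsub>S\<^esub> x = x \<and> x \<otimes>\<^bsub>S\<^esub> e = x"
    and a: "a \<in> carrier S" "a \<noteq> \<zero>\<^bsub>S\<^esub>"
  shows "a = e"
proof -
  interpret absorptive_hemiring S by fact
  let ?D = "{x \<in> carrier S. x \<oplus>\<^bsub>S\<^esub> a = a}"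
  have "y \<oplus>\<^bsub>S\<^esub> a = a" if "x \<in> ?D" "y \<in> carrier S" "y \<oplus>\<^bsub>S\<^esub> x = x" for x y
  proof -
    have "y \<oplus>\<^bsub>S\<^esub> a = (y \<oplus>\<^bsub>S\<^esub> x) \<oplus>\<^bsub>S\<^esub> a" using that(1,2) a(1) a_assoc by simp
    then show ?thesis using that by simp
  qed
  then have "hemiring_ideal ?D S"
    unfolding hemiring_ideal_def using a(1) by (auto simp: a_assoc m_closed absorb_left absorb_right)
  moreover have "a \<in> ?D"
    using absorb_left[OF a(1) e(1)] e a by simp
  ultimately have "?D = carrier S"
    using assms(2) a(2) unfolding ideal_simple_def by blast
  then have "e \<oplus>\<^bsub>S\<^esub> a = a" using e(1) by blast
  moreover have "a \<oplus>\<^bsub>S\<^esub> e = e" using absorb_right[OF a(1) e(1)] e a by simp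
  ultimately show "a = e" using a_comm[OF a(1) e(1)] by simp
qed

section \<open>Boolean characters\<close>

definition boolean_characters :: "('a, 'm) ring_scheme \<Rightarrow> ('a \<Rightarrow> bool) set" where
  "boolean_characters R =
     {\<chi> \<in> hemiring_hom R boolean_semifield. \<chi> ` carrier R = carrier boolean_semifield}"

lemma boolean_characterI:
  assumes "\<not> \<chi> \<zero>\<^bsub>R\<^esub>" "\<zero>\<^bsub>R\<^esub> \<in> carrier R" "u \<in> carrier R" "\<chi> u"
    and "\<And>x y. x \<in> carrier R \<Longrightarrow> y \<in> carrier R \<Longrightarrow> \<chi> (x \<oplus>\<^bsub>R\<^esub> y) \<longleftrightarrow> \<chi> x \<or> \<chi> y"
    and "\<And>x y. x \<in> carrier R \<Longrightarrow> y \<in> carrier R \<Longrightarrow> \<chi> (x \<otimes>\<^bsub>R\<^esub> y) \<longleftrightarrow> \<chi> x \<and> \<chi> y"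
  shows "\<chi> \<in> boolean_characters R"
proof -
  have "b \<in> \<chi> ` carrier R" for b
    using assms(1-4) by (cases b) (auto simp: image_iff)
  then show ?thesis
    using assms by (auto simp: boolean_characters_def hemiring_hom_def boolean_semifield_def)
qed

lemma boolean_characterD:
  assumes "\<chi> \<in> boolean_characters R"
  shows "\<not> \<chi> \<zero>\<^bsub>R\<^esub>"
    "x \<in> carrier R \<Longrightarrow> y \<in> carrier R \<Longrightarrow> \<chi> (x \<oplus>\<^bsub>R\<^esub> y) \<longleftrightarrow> \<chi> x \<or> \<chi> y"
    "x \<in> carrier R \<Longrightarrow> y \<in> carrier R \<Longrightarrow> \<chi> (x \<otimes>\<^bsub>R\<^esub> y) \<longleftrightarrow> \<chi> x \<and> \<chi> y"
    "\<exists>u\<in>carrier R. \<chi> u"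
proof -
  have "\<chi> ` carrier R = UNIV" using assms by (simp add: boolean_characters_def boolean_semifield_def)
  then show "\<exists>u\<in>carrier R. \<chi> u" by (metis UNIV_I imageE)
qed (use assms in \<open>auto simp: boolean_characters_def hemiring_hom_def boolean_semifield_def\<close>)

text \<open>The image \<open>S\<close> consists of \<open>0\<close> and \<open>1\<close> with \<open>1 + 1 = 1\<close>, so it is a copy of
  \<open>\<^bold>B\<close>, and testing for a nonzero value is the isomorphism.  This is how every nonzero
  ideal-simple semiring image gives rise to a character with the same kernel.\<close>

lemma nonzero_is_boolean_character:
  assumes R: "absorptive_hemiring R" and f: "f \<in> hemiring_hom R S" "f ` carrier R = carrier S"
    and S: "carrier S \<noteq> {\<zero>\<^bsub>S\<^esub>}" "is_semiring S" "ideal_simple S"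
  shows "(\<lambda>x. f x \<noteq> \<zero>\<^bsub>S\<^esub>) \<in> boolean_characters R"
proof -
  obtain e where e: "e \<in> carrier S" "\<And>x. x \<in> carrier S \<Longrightarrow> e \<otimes>\<^bsub>S\<^esub> x = x \<and> x \<otimes>\<^bsub>S\<^esub> e = x"
    and S': "hemiring S"
    using S(2) by (auto simp: is_semiring_def)
  interpret R: absorptive_hemiring R by fact
  interpret S: absorptive_hemiring S by (rule absorptive_hemiring_image[OF R f S'])
  have two: "x = \<zero>\<^bsub>S\<^esub> \<or> x = e" if "x \<in> carrier S" for x
    using ideal_simple_eq_zero_or_one[OF S.absorptive_hemiring_axioms S(3) e that] by blast
  have "e \<noteq> \<zero>\<^bsub>S\<^esub>" using S(1) S.zero_closed two by auto
  moreover have "e \<oplus>\<^bsub>S\<^esub> e = e" using S.absorb_left[OF e(1) e(1)] e by simp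
  moreover obtain u where "u \<in> carrier R" "f u = e"
    using f(2) e(1) imageE[of e f "carrier R"] by metis
  moreover have "f \<zero>\<^bsub>R\<^esub> = \<zero>\<^bsub>S\<^esub>"
    "\<And>x y. x \<in> carrier R \<Longrightarrow> y \<in> carrier R \<Longrightarrow> f (x \<oplus>\<^bsub>R\<^esub> y) = f x \<oplus>\<^bsub>S\<^esub> f y"
    "\<And>x y. x \<in> carrier R \<Longrightarrow> y \<in> carrier R \<Longrightarrow> f (x \<otimes>\<^bsub>R\<^esub> y) = f x \<otimes>\<^bsub>S\<^esub> f y"
    using f(1) by (auto simp: hemiring_hom_def)
  moreover have "(f x \<oplus>\<^bsub>S\<^esub> f y \<noteq> \<zero>\<^bsub>S\<^esub>) = (f x \<noteq> \<zero>\<^bsub>S\<^esub> \<or> f y \<noteq> \<zero>\<^bsub>S\<^esub>)"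
    "(f x \<otimes>\<^bsub>S\<^esub> f y \<noteq> \<zero>\<^bsub>S\<^esub>) = (f x \<noteq> \<zero>\<^bsub>S\<^esub> \<and> f y \<noteq> \<zero>\<^bsub>S\<^esub>)"
    if "x \<in> carrier R" "y \<in> carrier R" for x y
  proof -
    have "f x \<in> {\<zero>\<^bsub>S\<^esub>, e}" "f y \<in> {\<zero>\<^bsub>S\<^esub>, e}" using two f(2) that by blast+
    then show "(f x \<oplus>\<^bsub>S\<^esub> f y \<noteq> \<zero>\<^bsub>S\<^esub>) = (f x \<noteq> \<zero>\<^bsub>S\<^esub> \<or> f y \<noteq> \<zero>\<^bsub>S\<^esub>)"
      "(f x \<otimes>\<^bsub>S\<^esub> f y \<noteq> \<zero>\<^bsub>S\<^esub>) = (f x \<noteq> \<zero>\<^bsub>S\<^esub> \<and> f y \<noteq> \<zero>\<^bsub>S\<^esub>)"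
      using e \<open>e \<noteq> \<zero>\<^bsub>S\<^esub>\<close> \<open>e \<oplus>\<^bsub>S\<^esub> e = e\<close> S.l_null[OF S.zero_closed] by auto
  qed
  ultimately show ?thesis
    by (intro boolean_characterI[where u = u]) simp_all
qed

text \<open>With \<open>\<psi> u = 1\<close> the value \<open>\<psi> x = \<psi> u \<and> \<psi> x\<close> at a point of the ideal must equal
  \<open>\<psi> (u x)\<close>, and the latter makes sense for every \<open>x \<in> R\<close>.  The extension is multiplicative
  because \<open>\<psi> (uxy) = \<psi> (ux \<cdot> yu)\<close> while \<open>\<psi> (yu) = \<psi> (uyu) = \<psi> (uy)\<close>.\<close>

lemma (in hemiring) boolean_character_extend:
  assumes I: "hemiring_ideal I R" and \<psi>: "\<psi> \<in> boolean_characters (R\<lparr>carrier := I\<rparr>)"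
  shows "\<exists>\<chi>\<in>boolean_characters R. \<forall>x\<in>I. \<chi> x = \<psi> x"
proof -
  have sub: "\<And>x. x \<in> I \<Longrightarrow> x \<in> carrier R" "\<zero> \<in> I"
    and ml: "\<And>r x. r \<in> carrier R \<Longrightarrow> x \<in> I \<Longrightarrow> r \<otimes> x \<in> I"
    and mr: "\<And>r x. r \<in> carrier R \<Longrightarrow> x \<in> I \<Longrightarrow> x \<otimes> r \<in> I"
    using I by (auto simp: hemiring_ideal_def)
  have z: "\<not> \<psi> \<zero>"
    and add: "\<And>x y. x \<in> I \<Longrightarrow> y \<in> I \<Longrightarrow> \<psi> (x \<oplus> y) \<longleftrightarrow> \<psi> x \<or> \<psi> y"
    and mult: "\<And>x y. x \<in> I \<Longrightarrow> y \<in> I \<Longrightarrow> \<psi> (x \<otimes> y) \<longleftrightarrow> \<psi> x \<and> \<psi> y"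
    using boolean_characterD[OF \<psi>] by auto
  obtain u where u: "u \<in> I" "\<psi> u" using boolean_characterD(4)[OF \<psi>] by auto
  have eq: "\<psi> (u \<otimes> x) = \<psi> x" if "x \<in> I" for x
    using mult[OF u(1) that] u by simp
  have "\<psi> (u \<otimes> (x \<otimes> y)) \<longleftrightarrow> \<psi> (u \<otimes> x) \<and> \<psi> (u \<otimes> y)" if xy: "x \<in> carrier R" "y \<in> carrier R" for x y
  proof -
    have "\<psi> (u \<otimes> (x \<otimes> y)) \<longleftrightarrow> \<psi> ((u \<otimes> (x \<otimes> y)) \<otimes> u)"
      using mult[OF mr u(1), of "x \<otimes> y" u] xy u m_closed by simp
    also have "(u \<otimes> (x \<otimes> y)) \<otimes> u = (u \<otimes> x) \<otimes> (y \<otimes> u)"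
      using xy sub(1)[OF u(1)] by (simp add: m_assoc m_closed)
    also have "\<psi> ((u \<otimes> x) \<otimes> (y \<otimes> u)) \<longleftrightarrow> \<psi> (u \<otimes> x) \<and> \<psi> (y \<otimes> u)"
      using mult mr ml xy u by simp
    also have "\<psi> (y \<otimes> u) = \<psi> ((u \<otimes> y) \<otimes> u)"
      using eq[OF ml[OF xy(2) u(1)]] xy sub(1)[OF u(1)] by (simp add: m_assoc)
    also have "\<dots> = \<psi> (u \<otimes> y)"
      using mult[OF mr[OF xy(2) u(1)] u(1)] u by simp
    finally show ?thesis .
  qed
  then have "(\<lambda>x. \<psi> (u \<otimes> x)) \<in> boolean_characters R"
    using u z eq[OF u(1)]
    by (intro boolean_characterI[where u = u])
      (auto simp: sub r_null r_distr add mr)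
  then show ?thesis by (rule bexI[rotated]) (simp add: eq)
qed

section \<open>The Boolean semifield\<close>

lemma boolean_semifield_simps:
  "carrier boolean_semifield = UNIV" "\<zero>\<^bsub>boolean_semifield\<^esub> = False"
  "x \<oplus>\<^bsub>boolean_semifield\<^esub> y \<longleftrightarrow> x \<or> y" "x \<otimes>\<^bsub>boolean_semifield\<^esub> y \<longleftrightarrow> x \<and> y"
  by (simp_all add: boolean_semifield_def)

lemma boolean_semifield_is_semiring: "is_semiring boolean_semifield"
  unfolding is_semiring_def
proof
  show "hemiring boolean_semifield"
    by unfold_locales (auto simp: boolean_semifield_simps)
qed (auto simp: boolean_semifield_simps)

lemma boolean_semifield_simple: "simple_hemiring boolean_semifield"
  unfolding simple_hemiring_def ideal_simple_def congruence_simple_def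
proof (intro conjI allI impI)
  show "hemiring boolean_semifield" "hemiring boolean_semifield"
    using boolean_semifield_is_semiring by (auto simp: is_semiring_def)
  fix I assume "hemiring_ideal I boolean_semifield"
  then have "False \<in> I" by (simp add: hemiring_ideal_def boolean_semifield_simps)
  then have "x \<in> I \<longleftrightarrow> \<not> x \<or> True \<in> I" for x by (cases x) auto
  then have "I = {False} \<or> I = UNIV" by (cases "True \<in> I") auto
  then show "I = {\<zero>\<^bsub>boolean_semifield\<^esub>} \<or> I = carrier boolean_semifield"
    by (simp add: boolean_semifield_simps)
next
  fix \<rho> assume "hemiring_congruence \<rho> boolean_semifield"
  then have "refl \<rho>" "sym \<rho>"
    by (auto simp: hemiring_congruence_def boolean_semifield_simps equiv_def)
  then have "(x, x) \<in> \<rho>" "(x, y) \<in> \<rho> \<longleftrightarrow> (y, x) \<in> \<rho>" for x y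
    by (auto dest: reflD symD)
  then have "(x, y) \<in> \<rho> \<longleftrightarrow> x = y \<or> (True, False) \<in> \<rho>" for x y
    by (cases x; cases y) auto
  then have "\<rho> = Id \<or> \<rho> = UNIV"
    by (cases "(True, False) \<in> \<rho>") auto
  then show "\<rho> = Id_on (carrier boolean_semifield) \<or>
      \<rho> = carrier boolean_semifield \<times> carrier boolean_semifield"
    by (auto simp: boolean_semifield_simps)
qed

lemma boolean_semifield_lattice_ordered: "lattice_ordered boolean_semifield"
proof -
  let ?L = "\<lparr>carrier = UNIV, eq = (=), le = (\<le>)\<rparr> :: bool gorder"
  have least: "least ?L (a \<or> b) (Upper ?L {a, b})"
    and greatest: "greatest ?L (a \<and> b) (Lower ?L {a, b})" for a b
    by (auto simp: least_def greatest_def Upper_def Lower_def)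
  interpret L: partial_order ?L by unfold_locales auto
  interpret L: lattice ?L
    by unfold_locales (use least greatest in blast)+
  have "(a \<squnion>\<^bsub>?L\<^esub> b) = (a \<or> b)" "(a \<sqinter>\<^bsub>?L\<^esub> b) = (a \<and> b)" for a b
    using L.join_unique[OF least] L.meet_unique[OF greatest] by auto
  then show ?thesis
    unfolding lattice_ordered_def Let_def
    using boolean_semifield_is_semiring L.lattice_axioms
    by (intro conjI exI[of _ "(\<le>)"]) (auto simp: is_semiring_def boolean_semifield_simps)
qed

section \<open>The two radicals\<close>

definition character_kernel :: "('a, 'm) ring_scheme \<Rightarrow> 'a set" where
  "character_kernel R = {r \<in> carrier R. \<forall>\<chi>\<in>boolean_characters R. \<not> \<chi> r}"

lemma (in hemiring) character_kernel_ideal: "hemiring_ideal (character_kernel R) R"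
  unfolding hemiring_ideal_def
proof (intro conjI ballI)
  show "character_kernel R \<subseteq> carrier R" by (auto simp: character_kernel_def)
  show "\<zero> \<in> character_kernel R"
    using boolean_characterD(1) by (fastforce simp: character_kernel_def)
next
  fix x y assume "x \<in> character_kernel R" "y \<in> character_kernel R"
  then show "x \<oplus> y \<in> character_kernel R"
    using boolean_characterD(2)[of _ R x y] by (auto simp: character_kernel_def)
next
  fix x r assume "x \<in> character_kernel R" "r \<in> carrier R"
  then show "r \<otimes> x \<in> character_kernel R" "x \<otimes> r \<in> character_kernel R"
    using boolean_characterD(3)[of _ R x r] boolean_characterD(3)[of _ R r x]
    by (auto simp: character_kernel_def m_closed)
qed

text \<open>A character that does not vanish on an ideal \<open>I\<close> restricts to a character of \<open>I\<close>, so \<open>I\<close>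
  has the image \<open>\<^bold>B\<close> and lies outside the Brown-McCoy class.  The common kernel of
  all characters lies in the class: a character of this ideal would extend to a character of
  \<open>R\<close> that does not vanish on it.\<close>

lemma (in absorptive_hemiring) BM_radical_eq_character_kernel: "BM_radical R = character_kernel R"
proof
  show "BM_radical R \<subseteq> character_kernel R"
  proof
    fix x assume "x \<in> BM_radical R"
    then obtain I where I: "hemiring_ideal I R" "BM_class (R\<lparr>carrier := I\<rparr>)" "x \<in> I"
      by (auto simp: BM_radical_def)
    have sub: "I \<subseteq> carrier R" "\<zero> \<in> I" using I(1) by (auto simp: hemiring_ideal_def)
    have "\<not> \<chi> x" if \<chi>: "\<chi> \<in> boolean_characters R" for \<chi>
    proof
      assume "\<chi> x"
      then have "\<chi> \<in> boolean_characters (R\<lparr>carrier := I\<rparr>)"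
        using boolean_characterD(1-3)[OF \<chi>] sub I(3)
        by (intro boolean_characterI[where u = x]) (auto simp: subset_iff)
      then have "\<not> BM_class (R\<lparr>carrier := I\<rparr>)"
        using boolean_semifield_is_semiring boolean_semifield_simple
        by (intro BM_class_any_type[where f = \<chi> and S = boolean_semifield])
          (auto simp: boolean_characters_def simple_hemiring_def boolean_semifield_simps)
      then show False using I(2) by contradiction
    qed
    then show "x \<in> character_kernel R" using sub I(3) by (auto simp: character_kernel_def)
  qed
next
  let ?K = "character_kernel R"
  note K = character_kernel_ideal
  interpret K: absorptive_hemiring "R\<lparr>carrier := ?K\<rparr>" by (rule absorptive_hemiring_ideal[OF K])
  have no_char: "boolean_characters (R\<lparr>carrier := ?K\<rparr>) = {}"
  proof (rule ccontr)
    assume "boolean_characters (R\<lparr>carrier := ?K\<rparr>) \<noteq> {}"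
    then obtain \<psi> where \<psi>: "\<psi> \<in> boolean_characters (R\<lparr>carrier := ?K\<rparr>)" by blast
    from boolean_character_extend[OF K \<psi>]
    obtain \<chi> where \<chi>: "\<chi> \<in> boolean_characters R" and ext: "\<forall>x\<in>?K. \<chi> x = \<psi> x"
      by (rule bexE)
    from boolean_characterD(4)[OF \<psi>] obtain u where "u \<in> ?K" "\<psi> u" by auto
    moreover have "\<not> \<chi> u" using \<open>u \<in> ?K\<close> \<chi> by (auto simp: character_kernel_def)
    ultimately show False using ext by simp
  qed
  have "BM_class (R\<lparr>carrier := ?K\<rparr>)"
    unfolding BM_class_def
  proof (intro conjI notI, goal_cases)
    case 1
    show ?case by (rule K.hemiring_axioms)
  next
    case 2
    then obtain S :: "'a set ring" and f where "f \<in> hemiring_hom (R\<lparr>carrier := ?K\<rparr>) S"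
      "f ` carrier (R\<lparr>carrier := ?K\<rparr>) = carrier S"
      "carrier S \<noteq> {\<zero>\<^bsub>S\<^esub>}" "is_semiring S" "ideal_simple S"
      by (elim exE conjE)
    from nonzero_is_boolean_character[OF K.absorptive_hemiring_axioms this] no_char
    show ?case by simp
  qed
  then show "?K \<subseteq> BM_radical R" using K unfolding BM_radical_def by blast
qed

lemma quotient_map_hom:
  assumes "hemiring R" "hemiring_congruence \<rho> R"
  shows "(\<lambda>x. \<rho> `` {x}) \<in> hemiring_hom R (quotient_hemiring R \<rho>)"
    "(\<lambda>x. \<rho> `` {x}) ` carrier R = carrier (quotient_hemiring R \<rho>)"
proof -
  have eq: "equiv (carrier R) \<rho>"
    and comp: "\<forall>(a, b)\<in>\<rho>. \<forall>(c, d)\<in>\<rho>.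
      (a \<oplus>\<^bsub>R\<^esub> c, b \<oplus>\<^bsub>R\<^esub> d) \<in> \<rho> \<and> (a \<otimes>\<^bsub>R\<^esub> c, b \<otimes>\<^bsub>R\<^esub> d) \<in> \<rho>"
    using assms(2) by (simp_all add: hemiring_congruence_def)
  have "\<rho> `` {a \<oplus>\<^bsub>R\<^esub> c} = \<rho> `` {b \<oplus>\<^bsub>R\<^esub> d}" "\<rho> `` {a \<otimes>\<^bsub>R\<^esub> c} = \<rho> `` {b \<otimes>\<^bsub>R\<^esub> d}"
    if "(a, b) \<in> \<rho>" "(c, d) \<in> \<rho>" for a b c d
    using bspec[OF comp that(1)] that(2) by (auto intro!: equiv_class_eq[OF eq])
  then have "congruent2 \<rho> \<rho> (\<lambda>x y. \<rho> `` {x \<oplus>\<^bsub>R\<^esub> y})" "congruent2 \<rho> \<rho> (\<lambda>x y. \<rho> `` {x \<otimes>\<^bsub>R\<^esub> y})"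
    by (simp_all add: congruent2I')
  then show "(\<lambda>x. \<rho> `` {x}) \<in> hemiring_hom R (quotient_hemiring R \<rho>)"
    by (auto simp: hemiring_hom_def quotient_hemiring_def quotientI UN_equiv_class2[OF eq eq])
  show "(\<lambda>x. \<rho> `` {x}) ` carrier R = carrier (quotient_hemiring R \<rho>)"
    by (auto simp: quotient_hemiring_def quotient_def)
qed

text \<open>The classes of this congruence are the two fibres of the character, so the quotient is
  \<open>\<^bold>B\<close> with each truth value replaced by its fibre.\<close>

lemma boolean_character_simple_congruence:
  assumes R: "hemiring R" and \<chi>: "\<chi> \<in> boolean_characters R"
  shows "{(a, b). a \<in> carrier R \<and> b \<in> carrier R \<and> \<chi> a = \<chi> b} \<in> simple_congruences R"
proof -
  interpret hemiring R by fact
  note D = boolean_characterD[OF \<chi>]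
  define \<rho> where "\<rho> = {(a, b). a \<in> carrier R \<and> b \<in> carrier R \<and> \<chi> a = \<chi> b}"
  have "equiv (carrier R) \<rho>"
    by (auto simp: \<rho>_def intro!: equivI refl_onI symI transI)
  then have \<rho>: "hemiring_congruence \<rho> R"
    by (auto simp: hemiring_congruence_def \<rho>_def D(2,3) m_closed)
  let ?Q = "quotient_hemiring R \<rho>"
  note q = quotient_map_hom[OF R \<rho>]
  define h where "h = (\<lambda>b. {a \<in> carrier R. \<chi> a = b})"
  have h: "\<rho> `` {a} = h (\<chi> a)" if "a \<in> carrier R" for a
    using that by (auto simp: h_def \<rho>_def)
  obtain u where u: "u \<in> carrier R" "\<chi> u" using D(4) by blast
  have rep: "\<exists>a\<in>carrier R. \<chi> a = b" for b
  proof (cases b)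
    case True
    then show ?thesis using u by auto
  next
    case False
    then show ?thesis using D(1) by (intro bexI[of _ "\<zero>\<^bsub>R\<^esub>"]) simp_all
  qed
  have "h \<in> hemiring_hom boolean_semifield ?Q"
    unfolding hemiring_hom_def mem_Collect_eq
  proof (intro conjI ballI)
    show "h \<in> carrier boolean_semifield \<rightarrow> carrier ?Q"
    proof
      fix b
      obtain a where a: "a \<in> carrier R" "\<chi> a = b" using rep by blast
      then have "\<rho> `` {a} \<in> carrier ?Q" using q(2) by blast
      then show "h b \<in> carrier ?Q" using h[OF a(1)] a(2) by simp
    qed
    show "h \<zero>\<^bsub>boolean_semifield\<^esub> = \<zero>\<^bsub>?Q\<^esub>"
      using h[OF zero_closed] D(1) by (simp add: quotient_hemiring_def boolean_semifield_simps)
    fix x y :: bool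
    obtain a b where ab: "a \<in> carrier R" "b \<in> carrier R" "\<chi> a = x" "\<chi> b = y" using rep by metis
    show "h (x \<oplus>\<^bsub>boolean_semifield\<^esub> y) = h x \<oplus>\<^bsub>?Q\<^esub> h y"
    proof -
      have "h (\<chi> (a \<oplus>\<^bsub>R\<^esub> b)) = h (\<chi> a) \<oplus>\<^bsub>?Q\<^esub> h (\<chi> b)"
        using q(1) ab(1,2) by (simp add: hemiring_hom_def m_closed flip: h)
      then show ?thesis by (simp add: D(2)[OF ab(1,2)] ab(3,4) boolean_semifield_simps)
    qed
    show "h (x \<otimes>\<^bsub>boolean_semifield\<^esub> y) = h x \<otimes>\<^bsub>?Q\<^esub> h y"
    proof -
      have "h (\<chi> (a \<otimes>\<^bsub>R\<^esub> b)) = h (\<chi> a) \<otimes>\<^bsub>?Q\<^esub> h (\<chi> b)"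
        using q(1) ab(1,2) by (simp add: hemiring_hom_def m_closed flip: h)
      then show ?thesis by (simp add: D(3)[OF ab(1,2)] ab(3,4) boolean_semifield_simps)
    qed
  qed
  moreover have "inj h"
    using rep unfolding h_def inj_def by blast
  moreover have "carrier ?Q = range h"
  proof -
    have "carrier ?Q = (\<lambda>a. h (\<chi> a)) ` carrier R" using q(2) h by force
    also have "\<dots> = h ` \<chi> ` carrier R" by (simp add: image_image)
    also have "\<chi> ` carrier R = UNIV" using rep by blast
    finally show ?thesis .
  qed
  ultimately have "hiso boolean_semifield ?Q h"
    using boolean_semifield_is_semiring by (simp add: hiso_def is_semiring_def boolean_semifield_simps)
  then show ?thesis
    unfolding \<rho>_def[symmetric]
    using \<rho> boolean_semifield_is_semiring boolean_semifield_simple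
      hiso_nonzero[of boolean_semifield ?Q h] hiso_is_semiring[of boolean_semifield ?Q h]
      hiso_ideal_simple[of boolean_semifield ?Q h] hiso_congruence_simple[of boolean_semifield ?Q h]
    by (auto simp: simple_congruences_def simple_hemiring_def Let_def boolean_semifield_simps)
qed

text \<open>Simple congruences and characters have the same zero classes: the quotient map followed by
  the test for a nonzero value is a character, and a character yields the congruence of its
  fibres.\<close>

lemma (in absorptive_hemiring) Cs_radical_eq_character_kernel: "Cs_radical R = character_kernel R"
proof
  show "Cs_radical R \<subseteq> character_kernel R"
  proof
    fix x assume x: "x \<in> Cs_radical R"
    have "\<not> \<chi> x" if \<chi>: "\<chi> \<in> boolean_characters R" for \<chi>
      using boolean_character_simple_congruence[OF hemiring_axioms \<chi>] x boolean_characterD(1)[OF \<chi>]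
      by (auto simp: Cs_radical_def zero_class_def)
    then show "x \<in> character_kernel R"
      using x by (auto simp: Cs_radical_def character_kernel_def)
  qed
next
  have "(x, \<zero>) \<in> \<rho>" if x: "x \<in> character_kernel R" and \<rho>: "\<rho> \<in> simple_congruences R" for x \<rho>
  proof -
    let ?Q = "quotient_hemiring R \<rho>"
    have c: "hemiring_congruence \<rho> R" and Q: "carrier ?Q \<noteq> {\<zero>\<^bsub>?Q\<^esub>}" "is_semiring ?Q" "ideal_simple ?Q"
      using \<rho> by (auto simp: simple_congruences_def simple_hemiring_def Let_def)
    have "(\<lambda>x. \<rho> `` {x} \<noteq> \<zero>\<^bsub>?Q\<^esub>) \<in> boolean_characters R"
      by (rule nonzero_is_boolean_character[OF absorptive_hemiring_axioms
            quotient_map_hom[OF hemiring_axioms c] Q])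
    then have "\<rho> `` {x} = \<rho> `` {\<zero>}"
      using x by (auto simp: character_kernel_def quotient_hemiring_def)
    then show "(x, \<zero>) \<in> \<rho>"
      using x c by (auto simp: character_kernel_def hemiring_congruence_def eq_equiv_class_iff)
  qed
  then show "character_kernel R \<subseteq> Cs_radical R"
    by (auto simp: Cs_radical_def character_kernel_def zero_class_def)
qed

section \<open>Subdirect products\<close>

lemma (in absorptive_hemiring) semiiso_subdirect_simple_character_kernel:
  assumes "semiiso_subdirect_simple R"
  shows "character_kernel R = {\<zero>}"
proof -
  obtain I :: "('a \<times> 'a) set set" and T :: "('a \<times> 'a) set \<Rightarrow> 'a set ring" and S
    where T: "\<And>i. i \<in> I \<Longrightarrow> is_semiring (T i) \<and> simple_hemiring (T i) \<and> lattice_ordered (T i)"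
      and S: "subdirect_product S I T" "semiisomorphic R ((product_hemiring I T)\<lparr>carrier := S\<rparr>)"
    using assms unfolding semiiso_subdirect_simple_def by blast
  obtain f where f: "\<And>i. i \<in> I \<Longrightarrow> (\<lambda>a. f a i) \<in> hemiring_hom R (T i)"
    "\<And>i. i \<in> I \<Longrightarrow> (\<lambda>a. f a i) ` carrier R = carrier (T i)"
    "\<And>a. a \<in> carrier R \<Longrightarrow> (\<forall>i\<in>I. f a i = \<zero>\<^bsub>T i\<^esub>) \<Longrightarrow> a = \<zero>"
    using semiiso_subdirectE[OF S] by metis
  have "a = \<zero>" if a: "a \<in> character_kernel R" for a
  proof (rule f(3))
    show aR: "a \<in> carrier R" using a by (simp add: character_kernel_def)
    show "\<forall>i\<in>I. f a i = \<zero>\<^bsub>T i\<^esub>"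
    proof
      fix i assume i: "i \<in> I"
      show "f a i = \<zero>\<^bsub>T i\<^esub>"
      \<comment> \<open>The zero hemiring is a simple semiring too, so a factor may vanish.\<close>
      proof (cases "carrier (T i) = {\<zero>\<^bsub>T i\<^esub>}")
        case True
        then show ?thesis using f(2)[OF i] aR by blast
      next
        case False
        then have "(\<lambda>a. f a i \<noteq> \<zero>\<^bsub>T i\<^esub>) \<in> boolean_characters R"
          using nonzero_is_boolean_character[OF absorptive_hemiring_axioms f(1,2)[OF i]] T[OF i]
          by (simp add: simple_hemiring_def)
        then show ?thesis using a by (auto simp: character_kernel_def)
      qed
    qed
  qed
  then show ?thesis using character_kernel_ideal by (auto simp: hemiring_ideal_def)
qed

lemma (in hemiring) character_kernel_semiiso_subdirect_boolean:
  assumes "character_kernel R = {\<zero>}"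
  shows "semiiso_subdirect_boolean R"
proof -
  have "\<exists>S. subdirect_product S (boolean_characters R) (\<lambda>_. boolean_semifield) \<and>
      semiisomorphic R ((product_hemiring (boolean_characters R) (\<lambda>_. boolean_semifield))\<lparr>carrier := S\<rparr>)"
    using assms
    by (intro semiiso_subdirectI[where g = "\<lambda>\<chi>. \<chi>", OF hemiring_axioms])
      (auto simp: boolean_characters_def character_kernel_def boolean_semifield_simps)
  then show ?thesis
    using semiiso_subdirect_boolean_any_type[OF hemiring_axioms] by blast
qed

lemma semiiso_subdirect_boolean_imp_simple:
  fixes R :: "('a, 'm) ring_scheme"
  assumes "hemiring R" "semiiso_subdirect_boolean R"
  shows "semiiso_subdirect_simple R"
proof -
  obtain I :: "('a \<times> 'a) set set" and S
    where S: "subdirect_product S I (\<lambda>_. boolean_semifield)"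
      "semiisomorphic R ((product_hemiring I (\<lambda>_. boolean_semifield))\<lparr>carrier := S\<rparr>)"
    using assms(2) unfolding semiiso_subdirect_boolean_def by (elim exE conjE)
  show ?thesis
    by (rule semiiso_subdirect_simple_any_type[OF assms(1) _ S])
      (simp add: boolean_semifield_is_semiring boolean_semifield_simple
        boolean_semifield_lattice_ordered)
qed

theorem corollary3p17:
  fixes R :: "('a, 'm) ring_scheme"
  assumes "lattice_ordered R"
  shows "(BM_radical R = {\<zero>\<^bsub>R\<^esub>} \<longleftrightarrow> Cs_radical R = {\<zero>\<^bsub>R\<^esub>}) \<and>
         (Cs_radical R = {\<zero>\<^bsub>R\<^esub>} \<longleftrightarrow> semiiso_subdirect_simple R) \<and>
         (semiiso_subdirect_simple R \<longleftrightarrow> semiiso_subdirect_boolean R)"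
proof -
  interpret absorptive_hemiring R by (rule lattice_ordered_absorptive[OF assms])
  show ?thesis
    using BM_radical_eq_character_kernel Cs_radical_eq_character_kernel
      semiiso_subdirect_simple_character_kernel character_kernel_semiiso_subdirect_boolean
      semiiso_subdirect_boolean_imp_simple[OF hemiring_axioms]
    by auto
qed

end
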